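(* Suppose $\{a_m\}_{m\ge0}$ is a real sequence with $a_m\to A$, and $u\in C(\overline\Omega)$ solves the boundary value problem $\Delta u=0$ on $\Omega$, $u(q_1)=a_0$, $u(x_m)=a_m$ $(m\ge1)$. Then $\mathcal E(u)<\infty$ if and only if $$\big\|(5/3)^{m/2}(a_m-A)\big\|_{\ell^2}<\infty .$$ Additionally, there is a constant $C$ (independent of $u$ and of the data) such that $$\mathcal E(u)\le C\,\big\|(5/3)^{m/2}(a_m-A)\big\|_{\ell^2}^2 .$$ Here $\|(5/3)^{m/2}c_m\|_{\ell^2}^2=\sum_{m\ge0}(5/3)^m|c_m|^2$.
   Context: Let $q_0,q_1,q_2$ be the vertices of an equilateral triangle, $F_j(x)=(x+q_j)/2$, and let $SG$ be the Sierpinski gasket, the nonempty compact set with $SG=\bigcup_{j=0}^2F_jSG$; $V_0=\{q_0,q_1,q_2\}$, $V_m=\bigcup_jF_jV_{m-1}$. A cell of level $m$ is $F_{w_1}\cdots F_{w_m}SG$; its boundary points are $F_{w_1}\cdots F_{w_m}q_j$, $j=0,1,2$. Half gasket: $x_m=F_0^{m-1}F_2q_1$ ($m\ge1$), $y_m=F_0^mq_1$ ($m\ge0$, so $y_0=q_1$), $\overline Y_m=F_0^{m-1}F_1SG$ ($m\ge 1$), a level-$m$ cell with boundary points $y_{m-1},y_m,x_m$. Put $X=\{x_m\}_{m\ge1}$, $\overline\Omega=\{q_0\}\cup\bigcup_{m\ge1}\overline Y_m$, $\partial\Omega=\{q_0,q_1\}\cup X$, $\Omega=\overline\Omega\setminus\partial\Omega$.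 A function on a cell is harmonic if it is the continuous function determined by its values at the three boundary points $v_0,v_1,v_2$ through the harmonic extension algorithm: at the level-one-finer junction point between $v_i$ and $v_j$ it takes the value $(2u(v_i)+2u(v_j)+u(v_k))/5$, and this is iterated on all smaller cells. $\Delta$ is the Kigami Laplacian for the standard measure. "$\Delta u=0$ on $\Omega$" means: $u$ is harmonic on each $\overline Y_m$, and at each $y_m$, $m\ge1$, the normal derivatives match: $$\Big(\tfrac53\Big)^m[2u(y_m)-u(y_{m-1})-u(x_m)]+\Big(\tfrac53\Big)^{m+1}[2u(y_m)-u(y_{m+1})-u(x_{m+1})]=0 .$$ Energy: on a cell, the energy of $u$ is the limit as $n\to\infty$ of $\sum(5/3)^n(u(x)-u(y))^2$ over unordered pairs of distinct points $x,y\in V_n$ lying in a common level-$n$ cell contained in the given cell. For $u$ on $\overline\Omega$, $\mathcal E(u)\in[0,\infty]$ is the sum over $m\ge1$ of the energies on $\overline Y_m$; for $u$ harmonic on each $\overline Y_m$ this equals $$\mathcal E(u)=\sum_{m=1}^\infty\Big(\tfrac53\Big)^m\big[(u(y_m)-u(y_{m-1}))^2+(u(y_m)-u(x_m))^2+(u(y_{m-1})-u(x_m))^2\big].$$ *)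

theory Defs
  imports "HOL-Analysis.Analysis"
begin

text \<open>The triangle is given by its vertices \<open>q 0\<close>, \<open>q 1\<close>, \<open>q 2\<close> in the plane; other
  values of \<open>q\<close> are never used.\<close>

definition equilateral :: "(nat \<Rightarrow> complex) \<Rightarrow> bool" where
  "equilateral q \<longleftrightarrow> q 0 \<noteq> q 1 \<and>
     dist (q 0) (q 1) = dist (q 1) (q 2) \<and> dist (q 1) (q 2) = dist (q 2) (q 0)"

definition sgF :: "(nat \<Rightarrow> complex) \<Rightarrow> nat \<Rightarrow> complex \<Rightarrow> complex" where
  "sgF q j x = (x + q j) / 2"

definition SG :: "(nat \<Rightarrow> complex) \<Rightarrow> complex set" where
  "SG q = (THE K. K \<noteq> {} \<and> compact K \<and> K = (\<Union>j<3. sgF q j ` K))"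

primrec sgV :: "(nat \<Rightarrow> complex) \<Rightarrow> nat \<Rightarrow> complex set" where
  "sgV q 0 = {q 0, q 1, q 2}"
| "sgV q (Suc m) = (\<Union>j<3. sgF q j ` sgV q m)"

definition sg_words :: "nat \<Rightarrow> nat list set" where
  "sg_words n = {w. length w = n \<and> set w \<subseteq> {..<3}}"

text \<open>For a word \<open>w = [w\<^sub>1, \<dots>, w\<^sub>m]\<close> this is the composition
  \<open>F\<^bsub>w\<^sub>1\<^esub> \<circ> \<dots> \<circ> F\<^bsub>w\<^sub>m\<^esub>\<close>.\<close>

definition sgFw :: "(nat \<Rightarrow> complex) \<Rightarrow> nat list \<Rightarrow> complex \<Rightarrow> complex" where
  "sgFw q w = foldr (sgF q) w"

definition sg_cell :: "(nat \<Rightarrow> complex) \<Rightarrow> nat list \<Rightarrow> complex set" where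
  "sg_cell q w = sgFw q w ` SG q"

text \<open>\<open>half_x q m\<close> and \<open>half_Y q m\<close> are meant for \<open>m \<ge> 1\<close> only.\<close>

definition half_x :: "(nat \<Rightarrow> complex) \<Rightarrow> nat \<Rightarrow> complex" where
  "half_x q m = (sgF q 0 ^^ (m - 1)) (sgF q 2 (q 1))"

definition half_y :: "(nat \<Rightarrow> complex) \<Rightarrow> nat \<Rightarrow> complex" where
  "half_y q m = (sgF q 0 ^^ m) (q 1)"

definition half_Y :: "(nat \<Rightarrow> complex) \<Rightarrow> nat \<Rightarrow> complex set" where
  "half_Y q m = (sgF q 0 ^^ (m - 1)) ` sgF q 1 ` SG q"

definition half_Omega_bar :: "(nat \<Rightarrow> complex) \<Rightarrow> complex set" where
  "half_Omega_bar q = {q 0} \<union> (\<Union>m\<in>{1..}. half_Y q m)"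

text \<open>The argument \<open>K\<close> is intended to be a cell; the cells contained in it are \<open>K\<close> itself and
  all smaller cells occurring in the iteration of the harmonic extension algorithm.
  The junction point between the corners \<open>F\<^sub>w q\<^sub>i\<close> and \<open>F\<^sub>w q\<^sub>j\<close> of
  the cell of \<open>w\<close> is \<open>F\<^sub>w F\<^sub>i q\<^sub>j = F\<^sub>w F\<^sub>j q\<^sub>i\<close>.\<close>

definition sg_harmonic_on :: "(nat \<Rightarrow> complex) \<Rightarrow> complex set \<Rightarrow> (complex \<Rightarrow> real) \<Rightarrow> bool" where
  "sg_harmonic_on q K u \<longleftrightarrow> continuous_on K u \<and>
     (\<forall>n. \<forall>w\<in>sg_words n. sg_cell q w \<subseteq> K \<longrightarrow>
       (\<forall>i j k. {i, j, k} = {0, 1, 2} \<longrightarrow>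
          u (sgFw q w (sgF q i (q j))) =
            (2 * u (sgFw q w (q i)) + 2 * u (sgFw q w (q j)) + u (sgFw q w (q k))) / 5))"

text \<open>This is the equation \<open>\<Delta>u = 0\<close> for the Kigami Laplacian on
  \<open>\<Omega> = half_Omega_bar q - ({q 0, q 1} \<union> {half_x q m | m. m \<ge> 1})\<close>: the second
  conjunct says that the normal derivatives from the two cells meeting at \<open>half_y q m\<close>
  cancel.\<close>

definition half_Laplace_zero :: "(nat \<Rightarrow> complex) \<Rightarrow> (complex \<Rightarrow> real) \<Rightarrow> bool" where
  "half_Laplace_zero q u \<longleftrightarrow>
     (\<forall>m\<ge>1. sg_harmonic_on q (half_Y q m) u) \<and>
     (\<forall>m\<ge>1.
        (5/3)^m * (2 * u (half_y q m) - u (half_y q (m - 1)) - u (half_x q m)) +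
        (5/3)^(m + 1) * (2 * u (half_y q m) - u (half_y q (m + 1)) - u (half_x q (m + 1))) = 0)"

definition half_bvp_solution ::
    "(nat \<Rightarrow> complex) \<Rightarrow> (nat \<Rightarrow> real) \<Rightarrow> (complex \<Rightarrow> real) \<Rightarrow> bool" where
  "half_bvp_solution q a u \<longleftrightarrow>
     continuous_on (half_Omega_bar q) u \<and> half_Laplace_zero q u \<and>
     u (q 1) = a 0 \<and> (\<forall>m\<ge>1. u (half_x q m) = a m)"

definition sg_edges :: "(nat \<Rightarrow> complex) \<Rightarrow> nat \<Rightarrow> complex set \<Rightarrow> (complex \<times> complex) set" where
  "sg_edges q n K = {(x, y). x \<in> sgV q n \<and> y \<in> sgV q n \<and> x \<noteq> y \<and>
     (\<exists>w\<in>sg_words n. x \<in> sg_cell q w \<and> y \<in> sg_cell q w \<and> sg_cell q w \<subseteq> K)}"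

text \<open>\<open>sg_edges\<close> contains every unordered pair in both orders, hence the factor \<open>1/2\<close>.\<close>

definition sg_level_energy ::
    "(nat \<Rightarrow> complex) \<Rightarrow> nat \<Rightarrow> complex set \<Rightarrow> (complex \<Rightarrow> real) \<Rightarrow> real" where
  "sg_level_energy q n K u = (\<Sum>(x, y)\<in>sg_edges q n K. (5/3)^n * (u x - u y)\<^sup>2) / 2"

definition sg_cell_energy ::
    "(nat \<Rightarrow> complex) \<Rightarrow> complex set \<Rightarrow> (complex \<Rightarrow> real) \<Rightarrow> ennreal" where
  "sg_cell_energy q K u = lim (\<lambda>n. ennreal (sg_level_energy q n K u))"

definition half_energy :: "(nat \<Rightarrow> complex) \<Rightarrow> (complex \<Rightarrow> real) \<Rightarrow> ennreal" where
  "half_energy q u = (\<Sum>m. sg_cell_energy q (half_Y q (Suc m)) u)"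

definition ell2_norm :: "(nat \<Rightarrow> real) \<Rightarrow> ennreal" where
  "ell2_norm c =
     (if summable (\<lambda>m. \<bar>c m\<bar>\<^sup>2) then ennreal (sqrt (\<Sum>m. \<bar>c m\<bar>\<^sup>2)) else \<infinity>)"

lemma sgF_dist: "dist (sgF q j x) (sgF q j y) = dist x y / 2"
proof -
  have "sgF q j x - sgF q j y = (x - y) / 2"
    by (simp add: sgF_def field_simps)
  then show ?thesis by (simp only: dist_norm norm_divide norm_numeral)
qed

lemma sgF_image: "sgF q j ` S = (\<lambda>x. q j / 2 + x) ` ((*\<^sub>R) (1/2)) ` S"
  by (auto simp: sgF_def image_image scaleR_conv_of_real add_divide_distrib add.commute)

lemma sgF_closure: "sgF q j ` closure S = closure (sgF q j ` S)"
  unfolding sgF_image closure_translation closure_scaleR ..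

lemma sg_invariant_subset:
  assumes K: "compact K" "K = (\<Union>j<3. sgF q j ` K)"
    and L: "L \<noteq> {}" "compact L" "L = (\<Union>j<3. sgF q j ` L)"
  shows "K \<subseteq> L"
proof
  fix x assume x: "x \<in> K"
  obtain l0 where l0: "l0 \<in> L" using L(1) by auto
  have "bounded K" using K(1) by (rule compact_imp_bounded)
  then obtain D where D: "\<And>x. x \<in> K \<Longrightarrow> dist l0 x \<le> D"
    unfolding bounded_any_center[of _ l0] by auto
  have near: "\<forall>x\<in>K. \<exists>l\<in>L. dist x l \<le> D / 2 ^ n" for n
  proof (induction n)
    case 0
    then show ?case using l0 D by (auto simp: dist_commute)
  next
    case (Suc n)
    show ?case
    proof
      fix x assume "x \<in> K"
      then have "x \<in> (\<Union>j<3. sgF q j ` K)" using K(2) by simp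
      then obtain j x' where j: "j < 3" "x' \<in> K" "x = sgF q j x'" by auto
      obtain l where l: "l \<in> L" "dist x' l \<le> D / 2 ^ n" using Suc j(2) by auto
      have "sgF q j l \<in> (\<Union>j<3. sgF q j ` L)" using l j by auto
      then have "sgF q j l \<in> L" using L(3) by simp
      moreover have "dist x (sgF q j l) \<le> D / 2 ^ Suc n"
        using l(2) by (simp add: j(3) sgF_dist field_simps)
      ultimately show "\<exists>l\<in>L. dist x l \<le> D / 2 ^ Suc n" by blast
    qed
  qed
  have "x \<in> closure L"
    unfolding closure_approachable
  proof (intro allI impI)
    fix e :: real assume e: "0 < e"
    have "(\<lambda>n. D * (1/2) ^ n) \<longlonglongrightarrow> D * 0"
      by (intro tendsto_mult tendsto_const LIMSEQ_power_zero) auto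
    then have "eventually (\<lambda>n. D * (1/2) ^ n < e) sequentially"
      using e by (intro order_tendstoD(2)[of _ 0]) auto
    then obtain n where n: "D / 2 ^ n < e"
      by (auto simp: eventually_sequentially power_divide)
    obtain l where "l \<in> L" "dist x l \<le> D / 2 ^ n" using near[of n] x by auto
    then show "\<exists>y\<in>L. dist y x < e" using n by (auto simp: dist_commute intro!: bexI[of _ l])
  qed
  then show "x \<in> L" using L(2) by (simp add: compact_imp_closed)
qed

lemma SG_ex1: "\<exists>!K. K \<noteq> {} \<and> compact K \<and> K = (\<Union>j<3. sgF q j ` K)"
proof (rule ex_ex1I)
  let ?V = "\<Union>n. sgV q n"
  let ?K = "closure ?V"
  have fixed: "q j = sgF q j (q j)" for j by (simp add: sgF_def)
  have lt3: "{..<3::nat} = {0, 1, 2}" by auto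
  have V0: "sgV q 0 \<subseteq> sgV q (Suc 0)"
    using fixed unfolding sgV.simps lt3 by blast
  have V: "?V = (\<Union>j<3. sgF q j ` ?V)"
  proof
    have "sgV q n \<subseteq> (\<Union>j<3. sgF q j ` ?V)" for n
    proof (cases n)
      case 0
      have "sgV q (Suc 0) \<subseteq> (\<Union>j<3. sgF q j ` ?V)" unfolding sgV.simps(2) by blast
      then show ?thesis using V0 0 by blast
    next
      case (Suc k)
      then show ?thesis by (auto simp del: sgV.simps(1))
    qed
    then show "?V \<subseteq> (\<Union>j<3. sgF q j ` ?V)" by blast
    show "(\<Union>j<3. sgF q j ` ?V) \<subseteq> ?V"
    proof
      fix x assume "x \<in> (\<Union>j<3. sgF q j ` ?V)"
      then obtain j n z where "j < 3" "z \<in> sgV q n" "x = sgF q j z" by blast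
      then have "x \<in> sgV q (Suc n)" by auto
      then show "x \<in> ?V" by blast
    qed
  qed
  define R where "R = norm (q 0) + norm (q 1) + norm (q 2)"
  have R: "norm (q j) \<le> R" if "j < 3" for j
    using that unfolding R_def by (auto simp: less_Suc_eq numeral_3_eq_3 numeral_2_eq_2)
  have "norm x \<le> R" if "x \<in> sgV q n" for n x
    using that
  proof (induction n arbitrary: x)
    case 0
    then show ?case using R[of 0] R[of 1] R[of 2] by auto
  next
    case (Suc n)
    then obtain j z where j: "j < 3" "z \<in> sgV q n" "x = sgF q j z" by auto
    have "norm (z + q j) \<le> R + R"
      using norm_triangle_mono[OF Suc.IH[OF j(2)] R[OF j(1)]] .
    then show ?case by (simp add: j(3) sgF_def norm_divide)
  qed
  then have "bounded ?V" unfolding bounded_iff by blast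
  then have "compact ?K" by (simp add: compact_closure)
  moreover have "q 0 \<in> sgV q 0" by simp
  then have "?K \<noteq> {}" by (metis UNIV_I UN_iff closure_eq_empty empty_iff)
  moreover have "?K = (\<Union>j<3. sgF q j ` ?K)"
  proof -
    have "closure (\<Union>j<3. sgF q j ` S) = (\<Union>j<3. sgF q j ` closure S)" for S
      by (simp add: lt3 sgF_closure)
    from this[of ?V] show ?thesis using V by argo
  qed
  ultimately show "\<exists>K. K \<noteq> {} \<and> compact K \<and> K = (\<Union>j<3. sgF q j ` K)"
    by (intro exI[of _ ?K] conjI)
next
  fix K L
  assume K: "K \<noteq> {} \<and> compact K \<and> K = (\<Union>j<3. sgF q j ` K)"
    and L: "L \<noteq> {} \<and> compact L \<and> L = (\<Union>j<3. sgF q j ` L)"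
  note k = K[THEN conjunct1] K[THEN conjunct2, THEN conjunct1] K[THEN conjunct2, THEN conjunct2]
  note l = L[THEN conjunct1] L[THEN conjunct2, THEN conjunct1] L[THEN conjunct2, THEN conjunct2]
  show "K = L"
    by (rule subset_antisym[OF sg_invariant_subset[OF k(2,3) l] sg_invariant_subset[OF l(2,3) k]])
qed

lemma SG_nonempty: "SG q \<noteq> {}"
  and SG_compact: "compact (SG q)"
  and SG_invariant: "SG q = (\<Union>j<3. sgF q j ` SG q)"
proof -
  note * = theI'[OF SG_ex1[of q], folded SG_def]
  show "SG q \<noteq> {}" by (rule *[THEN conjunct1])
  show "compact (SG q)" by (rule *[THEN conjunct2, THEN conjunct1])
  show "SG q = (\<Union>j<3. sgF q j ` SG q)" by (rule *[THEN conjunct2, THEN conjunct2])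
qed

end

theory Submission imports Defs begin

text \<open>
  On a single cell the renormalized energy of a harmonic function does not change when the cell
  is subdivided: the harmonic extension algorithm makes the three subcells carry together
  \<open>3/5\<close> of the corner energy of the cell, and the factor \<open>5/3\<close> per level undoes
  this. Hence the energy of a solution is the weighted sum, over the cells
  \<open>half_Y q m\<close>, of its squared corner differences
  (\<open>harmonic_cell_energy\<close>, \<open>half_energy_eq_ladder_energy\<close>). The geometric input is
  that two different cells of one level share at most one point, so that the edges of level
  \<open>n\<close> inside a cell correspond exactly to a word together with an ordered pair of different
  corners (\<open>sg_edges_eq_image\<close>, \<open>inj_on_word_edge\<close>).

  What is left concerns two sequences tending to \<open>0\<close>: the data \<open>c m = a m - A\<close> and
  \<open>b m = u (half_y q m) - A\<close>. (They have
  the same limit because \<open>u\<close> is continuous at \<open>q 0\<close>, to which both \<open>half_x q m\<close> and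
  \<open>half_y q m\<close> converge.) The matching
  of normal derivatives is the second-order recursion
  \<open>16 b\<^sub>m - 3 b\<^sub>m\<^sub>-\<^sub>1 - 5 b\<^sub>m\<^sub>+\<^sub>1 = 3 c\<^sub>m + 5 c\<^sub>m\<^sub>+\<^sub>1\<close>,
  with characteristic roots \<open>3\<close> and \<open>1/5\<close>.

  For the upper bound (\<open>ladder_energy_bound\<close>) the recursion is factored:
  \<open>z\<^sub>m = b\<^sub>m\<^sub>+\<^sub>1 - b\<^sub>m / 5\<close> satisfies
  \<open>z\<^sub>m = z\<^sub>m\<^sub>+\<^sub>1 / 3 + f\<^sub>m\<close>, where \<open>f\<close> is a combination of two
  consecutive data. Read from infinity downwards this is a contraction in the \<open>\<ell>\<^sup>2\<close> norm
  with weight \<open>(5/3)\<^sup>m\<close>, and since \<open>z\<close> tends to \<open>0\<close> the growing mode is absent;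
  then \<open>b\<close> is recovered from \<open>z\<close> by the upward recursion, whose ratio \<open>1/5\<close> is
  a contraction as well because \<open>5/3 \<cdot> (1/5)\<^sup>2 < 1\<close>.

  Conversely (\<open>ladder_energy_coercive\<close>), finite energy bounds the weighted norm of the
  increments of \<open>b\<close>. A Hardy inequality, which is the case of ratio \<open>1\<close> of the same
  downward recursion, bounds \<open>b\<close> itself, and the energy also controls \<open>b - c\<close>.
\<close>

section \<open>Weighted square-summability along linear recursions\<close>

text \<open>The factor \<open>4/3\<close> at \<open>x\<^sup>2\<close> is close enough to \<open>1\<close> to keep the contraction
that the weight \<open>5/3\<close> provides: \<open>4/3 \<cdot> 3/5 = 4/5 < 1\<close>.\<close>

lemma power2_add_le_weighted: "(x + y)\<^sup>2 \<le> 4/3 * x\<^sup>2 + 4 * y\<^sup>2" for x y :: real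
proof -
  have "4/3 * x\<^sup>2 + 4 * y\<^sup>2 - (x + y)\<^sup>2 = (x - 3 * y)\<^sup>2 / 3"
    by (simp add: power2_eq_square field_simps)
  then show ?thesis by (smt (verit) zero_le_power2 divide_nonneg_pos)
qed

text \<open>Going down from \<open>m + 1\<close> to \<open>m\<close> the weight gains the factor \<open>3/5\<close>, so that the
squared weighted norm of \<open>z\<close> is at most \<open>4/5\<close> of itself plus \<open>4\<close> times that of
\<open>f\<close>. To
absorb the first part it must be known to be finite. This is arranged by
subtracting a multiple of the homogeneous solution that makes the sequence vanish at some
\<open>N\<close>; as \<open>z\<close> tends to \<open>0\<close>, the subtracted term disappears for
\<open>N \<longlonglongrightarrow> \<infinity>\<close>. For \<open>r = 1\<close> this is a discrete Hardy inequality.\<close>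

lemma backward_recursion_weighted_l2:
  fixes z f :: "nat \<Rightarrow> real"
  assumes r: "\<bar>r\<bar> \<le> 1" and rec: "\<And>m. z m = r * z (Suc m) + f m"
    and lim: "z \<longlonglongrightarrow> 0" and sf: "summable (\<lambda>m. (5/3)^m * (f m)\<^sup>2)"
  shows "summable (\<lambda>m. (5/3)^m * (z m)\<^sup>2)"
    and "(\<Sum>m. (5/3)^m * (z m)\<^sup>2) \<le> 20 * (\<Sum>m. (5/3)^m * (f m)\<^sup>2)"
proof -
  define S where "S = (\<Sum>m. (5/3)^m * (f m)\<^sup>2)"
  have truncated: "(\<Sum>m<M. (5/3)^m * (z m - r^(N - m) * z N)\<^sup>2) \<le> 20 * S" if "M \<le> N" for M N
  proof -
    define e where "e m = z m - r^(N - m) * z N" for m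
    define g where "g m = (5/3)^m * (e m)\<^sup>2" for m
    have g0: "0 \<le> g m" for m by (simp add: g_def)
    have gN: "g N = 0" by (simp add: g_def e_def)
    have step: "g m \<le> 4/5 * g (Suc m) + 4 * ((5/3)^m * (f m)\<^sup>2)" if "m < N" for m
    proof -
      have "N - m = Suc (N - Suc m)" using that by simp
      then have "e m = r * e (Suc m) + f m"
        using rec[of m] by (simp add: e_def algebra_simps)
      then have "(e m)\<^sup>2 \<le> 4/3 * (r * e (Suc m))\<^sup>2 + 4 * (f m)\<^sup>2"
        using power2_add_le_weighted[of "r * e (Suc m)" "f m"] by simp
      also have "(r * e (Suc m))\<^sup>2 \<le> (e (Suc m))\<^sup>2"
        using r by (simp add: power_mult_distrib abs_square_le_1 mult_left_le_one_le)
      finally have *: "(e m)\<^sup>2 \<le> 4/3 * (e (Suc m))\<^sup>2 + 4 * (f m)\<^sup>2" by simp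
      show ?thesis
        using mult_left_mono[OF *, of "(5/3)^m"] by (simp add: g_def algebra_simps)
    qed
    have "(\<Sum>m<N. g m) \<le> (\<Sum>m<N. 4/5 * g (Suc m) + 4 * ((5/3)^m * (f m)\<^sup>2))"
      by (intro sum_mono step) simp
    also have "\<dots> = 4/5 * (\<Sum>m<N. g (Suc m)) + 4 * (\<Sum>m<N. (5/3)^m * (f m)\<^sup>2)"
      by (simp add: sum.distrib sum_distrib_left)
    also have "(\<Sum>m<N. (5/3)^m * (f m)\<^sup>2) \<le> S"
      unfolding S_def by (intro sum_le_suminf sf) auto
    finally have "(\<Sum>m<N. g m) \<le> 4/5 * (\<Sum>m<N. g (Suc m)) + 4 * S" by simp
    moreover have "(\<Sum>m<N. g (Suc m)) \<le> (\<Sum>m<N. g m)"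
      using sum.lessThan_Suc_shift[of g N] g0[of 0] gN by simp
    ultimately have "(\<Sum>m<N. g m) \<le> 20 * S" by linarith
    moreover have "(\<Sum>m<M. g m) \<le> (\<Sum>m<N. g m)"
      using that by (intro sum_mono2) (auto simp: g0)
    ultimately show ?thesis by (simp add: g_def e_def)
  qed
  have partial: "(\<Sum>m<M. (5/3)^m * (z m)\<^sup>2) \<le> 20 * S" for M
  proof -
    have "(\<lambda>N. r^(N - m) * z N) \<longlonglongrightarrow> 0" for m
    proof (rule Lim_null_comparison)
      show "(\<lambda>N. \<bar>z N\<bar>) \<longlonglongrightarrow> 0" using lim by (simp add: tendsto_rabs_zero)
      show "\<forall>\<^sub>F N in sequentially. norm (r^(N - m) * z N) \<le> \<bar>z N\<bar>"
        using r by (intro always_eventually allI)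
          (simp add: abs_mult power_abs power_le_one mult_left_le_one_le)
    qed
    from tendsto_diff[OF tendsto_const this]
    have "(\<lambda>N. \<Sum>m<M. (5/3)^m * (z m - r^(N - m) * z N)\<^sup>2)
        \<longlonglongrightarrow> (\<Sum>m<M. (5/3)^m * (z m - 0)\<^sup>2)"
      by (intro tendsto_sum tendsto_mult tendsto_power tendsto_const)
    then show ?thesis
      using truncated by (intro LIMSEQ_le_const2[of _ _ "20 * S"]) auto
  qed
  show "summable (\<lambda>m. (5/3)^m * (z m)\<^sup>2)"
    using partial by (intro summableI_nonneg_bounded) auto
  then show "(\<Sum>m. (5/3)^m * (z m)\<^sup>2) \<le> 20 * (\<Sum>m. (5/3)^m * (f m)\<^sup>2)"
    using partial by (fold S_def) (rule suminf_le_const)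
qed

text \<open>Going up, the weight costs \<open>5/3\<close> per step, which the ratio has to beat:
\<open>4/3 \<cdot> 5/3 \<cdot> (1/2)\<^sup>2 = 5/9 < 1\<close>. Partial sums can be absorbed directly, since the
recursion starts at the known value \<open>b 0\<close>.\<close>

lemma forward_recursion_weighted_l2:
  fixes b g :: "nat \<Rightarrow> real"
  assumes r: "\<bar>r\<bar> \<le> 1/2" and rec: "\<And>m. b (Suc m) = r * b m + g m"
    and sg: "summable (\<lambda>m. (5/3)^m * (g m)\<^sup>2)"
  shows "summable (\<lambda>m. (5/3)^m * (b m)\<^sup>2)"
    and "(\<Sum>m. (5/3)^m * (b m)\<^sup>2) \<le> 9/4 * (b 0)\<^sup>2 + 15 * (\<Sum>m. (5/3)^m * (g m)\<^sup>2)"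
proof -
  define S where "S = (\<Sum>m. (5/3)^m * (g m)\<^sup>2)"
  define h where "h m = (5/3)^m * (b m)\<^sup>2" for m
  have h0: "0 \<le> h m" for m by (simp add: h_def)
  have step: "h (Suc m) \<le> 5/9 * h m + 20/3 * ((5/3)^m * (g m)\<^sup>2)" for m
  proof -
    have "(b (Suc m))\<^sup>2 \<le> 4/3 * (r * b m)\<^sup>2 + 4 * (g m)\<^sup>2"
      using rec[of m] power2_add_le_weighted[of "r * b m" "g m"] by simp
    also have "(r * b m)\<^sup>2 \<le> (1/2 * b m)\<^sup>2"
      unfolding power_mult_distrib using r
      by (intro mult_right_mono) (auto simp: abs_le_square_iff[symmetric])
    finally have *: "(b (Suc m))\<^sup>2 \<le> 1/3 * (b m)\<^sup>2 + 4 * (g m)\<^sup>2"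
      by (simp add: power2_eq_square)
    show ?thesis
      using mult_left_mono[OF *, of "(5/3)^Suc m"] by (simp add: h_def algebra_simps)
  qed
  have partial: "(\<Sum>m<M. h m) \<le> 9/4 * (b 0)\<^sup>2 + 15 * S" for M
  proof -
    have "(\<Sum>m<M. h m) \<le> (\<Sum>m<Suc M. h m)" by (simp add: h0)
    also have "\<dots> = (b 0)\<^sup>2 + (\<Sum>m<M. h (Suc m))"
      by (subst sum.lessThan_Suc_shift) (simp add: h_def)
    also have "(\<Sum>m<M. h (Suc m)) \<le> (\<Sum>m<M. 5/9 * h m + 20/3 * ((5/3)^m * (g m)\<^sup>2))"
      by (intro sum_mono step)
    also have "\<dots> = 5/9 * (\<Sum>m<M. h m) + 20/3 * (\<Sum>m<M. (5/3)^m * (g m)\<^sup>2)"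
      by (simp add: sum.distrib sum_distrib_left)
    also have "(\<Sum>m<M. (5/3)^m * (g m)\<^sup>2) \<le> S"
      unfolding S_def by (intro sum_le_suminf sg) auto
    finally show ?thesis by simp
  qed
  show "summable (\<lambda>m. (5/3)^m * (b m)\<^sup>2)"
    using partial by (intro summableI_nonneg_bounded) (auto simp: h_def)
  then show "(\<Sum>m. (5/3)^m * (b m)\<^sup>2) \<le> 9/4 * (b 0)\<^sup>2 + 15 * (\<Sum>m. (5/3)^m * (g m)\<^sup>2)"
    using partial by (fold S_def) (auto simp: h_def intro: suminf_le_const)
qed

text \<open>The energy of the harmonic function on \<open>half_Y q (Suc m)\<close> when \<open>b m\<close>, \<open>b (Suc m)\<close>
and \<open>c (Suc m)\<close> are its values at \<open>half_y q m\<close>, \<open>half_y q (Suc m)\<close> and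
\<open>half_x q (Suc m)\<close>. Adding one constant to \<open>b\<close> and \<open>c\<close> changes nothing, so the
limit of the data may be subtracted.\<close>

definition ladder_energy :: "(nat \<Rightarrow> real) \<Rightarrow> (nat \<Rightarrow> real) \<Rightarrow> nat \<Rightarrow> real" where
  "ladder_energy b c m = (5/3)^Suc m *
     ((b (Suc m) - b m)\<^sup>2 + (b (Suc m) - c (Suc m))\<^sup>2 + (b m - c (Suc m))\<^sup>2)"

lemma ladder_energy_nonneg: "0 \<le> ladder_energy b c m"
  by (simp add: ladder_energy_def)

lemma power2_add_le: "(x + y)\<^sup>2 \<le> 2 * x\<^sup>2 + 2 * y\<^sup>2" for x y :: real
  using zero_le_power2[of "x - y"] by (simp add: power2_eq_square algebra_simps)

lemma power2_diff_le: "(x - y)\<^sup>2 \<le> 2 * x\<^sup>2 + 2 * y\<^sup>2" for x y :: real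
  using power2_add_le[of x "- y"] by simp

text \<open>The homogeneous recursion \<open>5 \<lambda>\<^sup>2 - 16 \<lambda> + 3 = 0\<close> has the roots \<open>3\<close> and
\<open>1/5\<close>. Splitting off the root \<open>1/5\<close> leaves a first-order recursion with root
\<open>3\<close>, solved downwards with ratio \<open>1/3\<close>.\<close>

lemma ladder_energy_bound:
  fixes b c :: "nat \<Rightarrow> real"
  assumes lim: "b \<longlonglongrightarrow> 0" and b0: "b 0 = c 0"
    and eq: "\<And>m. 16 * b (Suc m) - 3 * b m - 5 * b (Suc (Suc m)) = 3 * c (Suc m) + 5 * c (Suc (Suc m))"
    and sc: "summable (\<lambda>m. (5/3)^m * (c m)\<^sup>2)"
  shows "summable (ladder_energy b c)"
    and "(\<Sum>m. ladder_energy b c m) \<le> 700 * (\<Sum>m. (5/3)^m * (c m)\<^sup>2)"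
proof -
  define C where "C m = (5/3)^m * (c m)\<^sup>2" for m
  define B where "B m = (5/3)^m * (b m)\<^sup>2" for m
  define z where "z m = b (Suc m) - 1/5 * b m" for m
  define f where "f m = (3 * c (Suc m) + 5 * c (Suc (Suc m))) / 15" for m
  define F where "F m = (5/3)^m * (f m)\<^sup>2" for m
  define Z where "Z m = (5/3)^m * (z m)\<^sup>2" for m
  have C_nonneg: "0 \<le> C m" for m by (simp add: C_def)
  have sC: "summable C" "summable (\<lambda>m. C (Suc m))" "summable (\<lambda>m. C (Suc (Suc m)))"
    using sc summable_Suc_iff[of C] summable_Suc_iff[of "\<lambda>m. C (Suc m)"] unfolding C_def by auto
  have C1: "(\<Sum>m. C (Suc m)) \<le> suminf C"
    using suminf_split_head[OF sC(1)] C_nonneg[of 0] by simp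
  have C2: "(\<Sum>m. C (Suc (Suc m))) \<le> suminf C"
    using suminf_split_head[OF sC(2)] C_nonneg[of 1] C1 by simp
  \<comment> \<open>The weights of the shifted data contribute \<open>3/5\<close> and \<open>9/25\<close>:
    \<open>2 \<cdot> 9/225 \<cdot> 3/5 = 12/250\<close> and \<open>2 \<cdot> 25/225 \<cdot> 9/25 = 2/25\<close>.\<close>
  have F_le: "F m \<le> 12/250 * C (Suc m) + 2/25 * C (Suc (Suc m))" for m
  proof -
    have "(f m)\<^sup>2 \<le> (2 * (3 * c (Suc m))\<^sup>2 + 2 * (5 * c (Suc (Suc m)))\<^sup>2) / 225"
      using power2_add_le[of "3 * c (Suc m)" "5 * c (Suc (Suc m))"]
      by (simp add: f_def power_divide)
    from mult_left_mono[OF this, of "(5/3)^m"] show ?thesis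
      by (simp add: F_def C_def power_mult_distrib algebra_simps)
  qed
  have sF: "summable F"
    by (rule summable_comparison_test_ev[OF _ summable_add[OF
          summable_mult[OF sC(2), of "12/250"] summable_mult[OF sC(3), of "2/25"]]])
      (use F_le in \<open>auto intro!: always_eventually simp: F_def\<close>)
  have "suminf F \<le> (\<Sum>m. 12/250 * C (Suc m) + 2/25 * C (Suc (Suc m)))"
    by (intro suminf_le F_le sF summable_add summable_mult sC)
  also have "\<dots> = 12/250 * (\<Sum>m. C (Suc m)) + 2/25 * (\<Sum>m. C (Suc (Suc m)))"
    by (simp only: suminf_add[symmetric] suminf_mult summable_mult sC)
  also have "\<dots> \<le> 1/5 * suminf C"
    using C1 C2 suminf_nonneg[OF sC(1) C_nonneg] by simp
  finally have F_sum: "suminf F \<le> 1/5 * suminf C" .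
  have z_rec: "z m = 1/3 * z (Suc m) + f m" for m
    using eq[of m] by (simp add: z_def f_def field_simps)
  have "z \<longlonglongrightarrow> 0 - 1/5 * 0"
    unfolding z_def by (intro tendsto_intros LIMSEQ_Suc lim)
  then have z_lim: "z \<longlonglongrightarrow> 0" by simp
  have sZ: "summable Z" and Z_sum: "suminf Z \<le> 20 * suminf F"
    using backward_recursion_weighted_l2[OF _ z_rec z_lim sF[unfolded F_def]]
    by (simp_all add: Z_def[abs_def] F_def[abs_def])
  have b_rec: "b (Suc m) = 1/5 * b m + z m" for m by (simp add: z_def)
  have sB: "summable B" and "suminf B \<le> 9/4 * (b 0)\<^sup>2 + 15 * suminf Z"
    using forward_recursion_weighted_l2[OF _ b_rec sZ[unfolded Z_def]]
    by (simp_all add: Z_def[abs_def] B_def[abs_def])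
  moreover have "(b 0)\<^sup>2 \<le> suminf C"
    using suminf_split_head[OF sC(1)] suminf_nonneg[OF sC(2) C_nonneg]
    by (simp add: C_def b0)
  ultimately have B_sum: "suminf B \<le> 63 * suminf C"
    using Z_sum F_sum suminf_nonneg[OF sC(1) C_nonneg] by simp
  have sB1: "summable (\<lambda>m. B (Suc m))" using sB by (simp add: summable_Suc_iff)
  have e_le: "ladder_energy b c m \<le> 4 * B (Suc m) + 20/3 * B m + 4 * C (Suc m)" for m
  proof -
    have "(b (Suc m) - b m)\<^sup>2 + (b (Suc m) - c (Suc m))\<^sup>2 + (b m - c (Suc m))\<^sup>2
        \<le> 4 * (b (Suc m))\<^sup>2 + 4 * (b m)\<^sup>2 + 4 * (c (Suc m))\<^sup>2"
      using power2_diff_le[of "b (Suc m)" "b m"] power2_diff_le[of "b (Suc m)" "c (Suc m)"]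
        power2_diff_le[of "b m" "c (Suc m)"] by simp
    from mult_left_mono[OF this, of "(5/3)^Suc m"] show ?thesis
      by (simp add: ladder_energy_def B_def C_def algebra_simps)
  qed
  have sR: "summable (\<lambda>m. 4 * B (Suc m) + 20/3 * B m + 4 * C (Suc m))"
    by (intro summable_add summable_mult sB sB1 sC)
  show sE: "summable (ladder_energy b c)"
    by (rule summable_comparison_test_ev[OF _ sR])
      (use e_le ladder_energy_nonneg in \<open>auto intro!: always_eventually\<close>)
  have "suminf (ladder_energy b c) \<le> (\<Sum>m. 4 * B (Suc m) + 20/3 * B m + 4 * C (Suc m))"
    by (intro suminf_le e_le sE sR)
  also have "\<dots> = 4 * (\<Sum>m. B (Suc m)) + 20/3 * suminf B + 4 * (\<Sum>m. C (Suc m))"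
    by (simp only: suminf_add[symmetric] suminf_mult summable_mult summable_add sC sB sB1)
  also have "(\<Sum>m. B (Suc m)) \<le> suminf B"
    using suminf_split_head[OF sB] by (simp add: B_def)
  \<comment> \<open>\<open>(4 + 20/3) \<cdot> 63 + 4 = 676\<close>, rounded up.\<close>
  finally have "suminf (ladder_energy b c) \<le> 700 * suminf C"
    using B_sum C1 suminf_nonneg[OF sC(1) C_nonneg] by simp
  then show "suminf (ladder_energy b c) \<le> 700 * (\<Sum>m. (5/3)^m * (c m)\<^sup>2)"
    by (simp add: C_def[abs_def])
qed

lemma ladder_energy_coercive:
  fixes b c :: "nat \<Rightarrow> real"
  assumes lim: "b \<longlonglongrightarrow> 0" and se: "summable (ladder_energy b c)"
  shows "summable (\<lambda>m. (5/3)^m * (c m)\<^sup>2)"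
proof -
  have "summable (\<lambda>m. (5/3)^m * (b m - b (Suc m))\<^sup>2)"
  proof (rule summable_comparison_test_ev[OF _ se], intro always_eventually allI)
    fix m
    \<comment> \<open>Lowering the weight by one power only helps; it puts the increments into the
      form of the downward recursion.\<close>
    have "(5/3)^m * (b m - b (Suc m))\<^sup>2 \<le> (5/3)^Suc m * (b (Suc m) - b m)\<^sup>2"
      by (intro mult_mono) (auto simp: power2_commute)
    also have "\<dots> \<le> ladder_energy b c m"
      unfolding ladder_energy_def by (intro mult_left_mono) auto
    finally show "norm ((5/3)^m * (b m - b (Suc m))\<^sup>2) \<le> ladder_energy b c m" by simp
  qed
  then have sB: "summable (\<lambda>m. (5/3)^m * (b m)\<^sup>2)"
    by (intro backward_recursion_weighted_l2[of 1 b "\<lambda>m. b m - b (Suc m)"] lim) auto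
  then have "summable (\<lambda>m. 2 * ((5/3)^Suc m * (b (Suc m))\<^sup>2) + 2 * ladder_energy b c m)"
    by (intro summable_add summable_mult se) (simp only: summable_Suc_iff[of "\<lambda>m. (5/3)^m * (b m)\<^sup>2"])
  then have "summable (\<lambda>m. (5/3)^Suc m * (c (Suc m))\<^sup>2)"
  proof (rule summable_comparison_test_ev[rotated], intro always_eventually allI)
    fix m
    have "(c (Suc m))\<^sup>2 \<le> 2 * (b (Suc m))\<^sup>2 + 2 * (b (Suc m) - c (Suc m))\<^sup>2"
      using power2_diff_le[of "b (Suc m)" "b (Suc m) - c (Suc m)"] by simp
    also have "(b (Suc m) - c (Suc m))\<^sup>2 \<le>
        (b (Suc m) - b m)\<^sup>2 + (b (Suc m) - c (Suc m))\<^sup>2 + (b m - c (Suc m))\<^sup>2" by simp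
    finally have "(c (Suc m))\<^sup>2 \<le> 2 * (b (Suc m))\<^sup>2 + 2 *
        ((b (Suc m) - b m)\<^sup>2 + (b (Suc m) - c (Suc m))\<^sup>2 + (b m - c (Suc m))\<^sup>2)" by simp
    from mult_left_mono[OF this, of "(5/3)^Suc m"]
    show "norm ((5/3)^Suc m * (c (Suc m))\<^sup>2) \<le>
        2 * ((5/3)^Suc m * (b (Suc m))\<^sup>2) + 2 * ladder_energy b c m"
      by (simp add: ladder_energy_def algebra_simps)
  qed
  then show ?thesis by (simp only: summable_Suc_iff[of "\<lambda>m. (5/3)^m * (c m)\<^sup>2"])
qed

section \<open>Barycentric coordinates and the intersection of cells\<close>

text \<open>If the sides \<open>d\<close> and \<open>e\<close> at \<open>q 0\<close> were parallel, Lagrange's identity would give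
\<open>(d \<bullet> e)\<^sup>2 = \<bar>d\<bar>\<^sup>2 \<bar>e\<bar>\<^sup>2\<close>, but equal side lengths force
\<open>d \<bullet> e = \<bar>d\<bar>\<^sup>2 / 2\<close>.\<close>

lemma equilateral_nondegenerate:
  assumes "equilateral q"
  shows "Im (cnj (q 1 - q 0) * (q 2 - q 0)) \<noteq> 0"
proof
  define d e where "d = q 1 - q 0" and "e = q 2 - q 0"
  assume "Im (cnj (q 1 - q 0) * (q 2 - q 0)) = 0"
  then have "Im (cnj d * e) = 0" by (simp only: d_def e_def)
  then have im: "Re d * Im e = Im d * Re e" by simp
  have "norm d = norm (d - e)" "norm (d - e) = norm e" "d \<noteq> 0"
    using assms by (auto simp: equilateral_def dist_norm d_def e_def norm_minus_commute)
  then have "(norm d)\<^sup>2 = (norm (d - e))\<^sup>2" "(norm d)\<^sup>2 = (norm e)\<^sup>2" by simp_all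
  then have n: "2 * (Re d * Re e + Im d * Im e) = (Re d)\<^sup>2 + (Im d)\<^sup>2"
      "(Re e)\<^sup>2 + (Im e)\<^sup>2 = (Re d)\<^sup>2 + (Im d)\<^sup>2"
    unfolding cmod_power2 by (simp_all add: power2_eq_square algebra_simps)
  define N where "N = (Re d)\<^sup>2 + (Im d)\<^sup>2"
  have "(Re d * Re e + Im d * Im e)\<^sup>2 + (Re d * Im e - Im d * Re e)\<^sup>2
      = ((Re d)\<^sup>2 + (Im d)\<^sup>2) * ((Re e)\<^sup>2 + (Im e)\<^sup>2)"
    by (simp add: power2_eq_square algebra_simps)
  then have "(Re d * Re e + Im d * Im e)\<^sup>2 = N * N" using im n by (simp add: N_def)
  moreover have "Re d * Re e + Im d * Im e = N / 2" using n(1) by (simp add: N_def)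
  ultimately have "N = 0" by (simp add: power2_eq_square)
  then show False using \<open>d \<noteq> 0\<close> by (simp add: N_def complex_neq_0)
qed

text \<open>The coordinates serve as real-valued functions compatible with midpoints, hence with all the
maps \<open>sgF q j\<close>; they turn the position of a cell into inequalities.\<close>

lemma barycentric_coordinates:
  assumes "equilateral q"
  obtains b :: "nat \<Rightarrow> complex \<Rightarrow> real" where
    "\<And>j. continuous_on UNIV (b j)"
    "\<And>j x y. b j ((x + y) / 2) = (b j x + b j y) / 2"
    "\<And>i j. i < 3 \<Longrightarrow> j < 3 \<Longrightarrow> b i (q j) = (if i = j then 1 else 0)"
    "\<And>x. (\<Sum>j<3. b j x) = 1"
    "\<And>x. (\<Sum>j<3. b j x *\<^sub>R q j) = x"
proof -
  define d e where "d = q 1 - q 0" and "e = q 2 - q 0"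
  define D where "D = Im (cnj d * e)"
  have D: "D \<noteq> 0" using equilateral_nondegenerate[OF assms] by (simp add: D_def d_def e_def)
  \<comment> \<open>Cramer's rule for \<open>x - q 0 = s x * d + t x * e\<close>, with \<open>Im (cnj d * e)\<close> as determinant.\<close>
  define s where "s x = Im (cnj (x - q 0) * e) / D" for x
  define t where "t x = Im (cnj d * (x - q 0)) / D" for x
  define b where "b j x = (if j = 0 then 1 - s x - t x else if j = 1 then s x else t x)"
    for j :: nat and x
  have cont: "continuous_on UNIV s" "continuous_on UNIV t"
    unfolding s_def t_def using D by (auto intro!: continuous_intros)
  have aff: "s ((x + y) / 2) = (s x + s y) / 2" "t ((x + y) / 2) = (t x + t y) / 2" for x y
    using D by (auto simp: s_def t_def field_simps)
  have at_q: "s (q 0) = 0" "s (q 1) = 1" "s (q 2) = 0" "t (q 0) = 0" "t (q 1) = 0" "t (q 2) = 1"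
    using D unfolding s_def t_def d_def[symmetric] e_def[symmetric]
    by (simp_all add: D_def mult.commute)
  have rep: "s x *\<^sub>R d + t x *\<^sub>R e = x - q 0" for x
  proof -
    define v where "v = x - q 0"
    have "D * s x = Im (cnj v * e)" "D * t x = Im (cnj d * v)"
      using D by (simp_all add: s_def t_def v_def)
    then have "D *\<^sub>R (s x *\<^sub>R d + t x *\<^sub>R e) = Im (cnj v * e) *\<^sub>R d + Im (cnj d * v) *\<^sub>R e"
      by (simp only: scaleR_add_right scaleR_scaleR)
    also have "\<dots> = D *\<^sub>R v"
      by (rule complex_eqI) (simp_all add: D_def algebra_simps)
    finally show ?thesis using D by (simp add: v_def)
  qed
  have lt3: "{..<3::nat} = {0, 1, 2}" by auto
  show ?thesis
  proof (rule that[of b])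
    show "continuous_on UNIV (b j)" for j
      unfolding b_def using cont by (cases "j = 0"; cases "j = 1") (auto intro!: continuous_intros)
    show "b j ((x + y) / 2) = (b j x + b j y) / 2" for j x y
      by (simp add: b_def aff field_simps)
    show "b i (q j) = (if i = j then 1 else 0)" if "i < 3" "j < 3" for i j
    proof -
      have "i = 0 \<or> i = 1 \<or> i = 2" "j = 0 \<or> j = 1 \<or> j = 2" using that by linarith+
      then show ?thesis by (elim disjE) (simp_all add: b_def at_q del: One_nat_def)
    qed
    show "(\<Sum>j<3. b j x) = 1" for x by (simp add: lt3 b_def)
    show "(\<Sum>j<3. b j x *\<^sub>R q j) = x" for x
    proof -
      have "(\<Sum>j<3. b j x *\<^sub>R q j) = q 0 + (s x *\<^sub>R d + t x *\<^sub>R e)"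
        by (simp add: lt3 b_def d_def e_def algebra_simps)
      then show ?thesis by (simp add: rep)
    qed
  qed
qed

text \<open>The point of the gasket nearest to \<open>q j\<close> is moved by \<open>sgF q j\<close> to half its distance
from \<open>q j\<close>, so this distance is zero.\<close>

lemma corner_in_SG: "j < 3 \<Longrightarrow> q j \<in> SG q"
proof -
  assume j: "j < 3"
  obtain x where x: "x \<in> SG q" "\<And>y. y \<in> SG q \<Longrightarrow> dist (q j) x \<le> dist (q j) y"
    using distance_attains_inf[OF compact_imp_closed[OF SG_compact] SG_nonempty] by blast
  have "sgF q j x \<in> SG q" using SG_invariant[of q] x(1) j by blast
  then have "dist (q j) x \<le> dist (q j) (sgF q j x)" by (rule x(2))
  also have "\<dots> = dist (q j) x / 2"
    using sgF_dist[of q j "q j" x] by (simp add: sgF_def)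
  finally show ?thesis using x(1) by simp
qed

text \<open>A minimum on the gasket is attained at some \<open>sgF q j y\<close>, where the value is the mean of
\<open>f y\<close> and \<open>f (q j) \<ge> 0\<close>; so the minimum is at least half of itself.\<close>

lemma midpoint_affine_nonneg_on_SG:
  fixes f :: "complex \<Rightarrow> real"
  assumes cont: "continuous_on UNIV f" and aff: "\<And>x y. f ((x + y) / 2) = (f x + f y) / 2"
    and nonneg: "\<And>j. j < 3 \<Longrightarrow> 0 \<le> f (q j)" and x: "x \<in> SG q"
  shows "0 \<le> f x"
proof -
  obtain p where p: "p \<in> SG q" "\<And>y. y \<in> SG q \<Longrightarrow> f p \<le> f y"
    using continuous_attains_inf[OF SG_compact SG_nonempty continuous_on_subset[OF cont subset_UNIV]]
    by blast
  obtain j y where jy: "j < 3" "y \<in> SG q" "p = sgF q j y"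
    using p(1) SG_invariant[of q] by blast
  have "f p = (f y + f (q j)) / 2" by (simp add: jy(3) sgF_def aff)
  then have "0 \<le> f p" using p(2)[OF jy(2)] nonneg[OF jy(1)] by simp
  then show ?thesis using p(2)[OF x] by simp
qed

lemma sgF_fixed: "sgF q j (q j) = q j"
  by (simp add: sgF_def)

lemma sgF_inj: "sgF q j x = sgF q j y \<Longrightarrow> x = y"
  by (simp add: sgF_def)

lemma distinct_corners:
  assumes "equilateral q" "i < 3" "j < 3"
  shows "q i = q j \<longleftrightarrow> i = j"
proof -
  obtain b where "\<And>i j. i < 3 \<Longrightarrow> j < 3 \<Longrightarrow> b i (q j) = (if i = j then 1 else 0 :: real)"
    by (rule barycentric_coordinates[OF assms(1)]) blast
  then show ?thesis using assms(2,3) by (metis zero_neq_one)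
qed

text \<open>The coordinate \<open>j\<close> is at most \<open>1/2\<close> on the cell of \<open>i\<close> and at least \<open>1/2\<close>
on the cell of \<open>j\<close>. At a common point the preimage \<open>x\<close> therefore has the \<open>j\<close>-th
coordinate \<open>1\<close>, which only the corner \<open>q j\<close> has.\<close>

lemma first_level_cells_meet_in_junction:
  assumes eq: "equilateral q" and ij: "i < 3" "j < 3" "i \<noteq> j"
    and x: "x \<in> SG q" and y: "y \<in> SG q" and xy: "sgF q i x = sgF q j y"
  shows "x = q j"
proof -
  obtain b :: "nat \<Rightarrow> complex \<Rightarrow> real" where cont: "\<And>j. continuous_on UNIV (b j)"
    and aff: "\<And>j x y. b j ((x + y) / 2) = (b j x + b j y) / 2"
    and at: "\<And>i j. i < 3 \<Longrightarrow> j < 3 \<Longrightarrow> b i (q j) = (if i = j then 1 else 0)"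
    and sum1: "\<And>x. (\<Sum>j<3. b j x) = 1" and rep: "\<And>x. (\<Sum>j<3. b j x *\<^sub>R q j) = x"
    by (rule barycentric_coordinates[OF eq], rule that)
  have pos: "0 \<le> b k z" if "z \<in> SG q" "k < 3" for k z
    using midpoint_affine_nonneg_on_SG[OF cont aff _ that(1)] at that(2) by simp
  have "b j (sgF q i x) = b j (sgF q j y)" by (simp add: xy)
  then have bj: "b j x = b j y + 1" using at ij by (simp add: sgF_def aff)
  have "b j x + (\<Sum>k\<in>{..<3} - {j}. b k x) = 1"
    using sum1[of x] ij(2) by (simp add: sum.remove[of "{..<3}" j])
  moreover have nonneg: "0 \<le> (\<Sum>k\<in>{..<3} - {j}. b k x)" by (intro sum_nonneg pos x) auto
  ultimately have bj1: "b j x = 1" and rest: "(\<Sum>k\<in>{..<3} - {j}. b k x) = 0"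
    using bj pos[OF y ij(2)] by linarith+
  have zero: "b k x = 0" if "k \<in> {..<3} - {j}" for k
    using rest that pos[OF x] by (subst (asm) sum_nonneg_eq_0_iff) auto
  have "x = b j x *\<^sub>R q j + (\<Sum>k\<in>{..<3} - {j}. b k x *\<^sub>R q k)"
    using rep[of x] ij(2) by (simp add: sum.remove[of "{..<3}" j])
  then show ?thesis using bj1 zero by simp
qed

lemma sgFw_simps [simp]:
  "sgFw q [] x = x" "sgFw q (i # w) x = sgF q i (sgFw q w x)"
  "sgFw q (v @ w) x = sgFw q v (sgFw q w x)"
  by (simp_all add: sgFw_def foldr_append)

lemma sgFw_eq_iff: "sgFw q w x = sgFw q w y \<longleftrightarrow> x = y"
  by (induction w) (auto dest: sgF_inj)

lemma sg_words_0: "sg_words 0 = {[]}" by (auto simp: sg_words_def)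

lemma sg_words_SucE:
  assumes "w \<in> sg_words (Suc n)"
  obtains i v where "w = i # v" "i < 3" "v \<in> sg_words n"
  using assms by (cases w) (auto simp: sg_words_def)

lemma sgFw_SG: "w \<in> sg_words n \<Longrightarrow> x \<in> SG q \<Longrightarrow> sgFw q w x \<in> SG q"
proof (induction n arbitrary: w)
  case (Suc n)
  then obtain i v where "w = i # v" "i < 3" "v \<in> sg_words n" by (auto elim: sg_words_SucE)
  then show ?case using Suc.IH[of v] Suc.prems(2) SG_invariant[of q] by auto
qed (simp add: sg_words_0)

lemma sg_cell_Cons: "sg_cell q (i # w) = sgF q i ` sg_cell q w"
  by (auto simp: sg_cell_def)

lemma sg_cell_subset_SG: "w \<in> sg_words n \<Longrightarrow> sg_cell q w \<subseteq> SG q"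
  by (auto simp: sg_cell_def sgFw_SG)

text \<open>Words with a common first letter reduce to shorter words by injectivity of \<open>sgF q i\<close>; for
different first letters the cells already lie in two cells of level one.\<close>

lemma distinct_cells_meet_in_at_most_one_point:
  assumes "equilateral q"
  shows "w \<in> sg_words n \<Longrightarrow> v \<in> sg_words n \<Longrightarrow> w \<noteq> v \<Longrightarrow>
    x \<in> sg_cell q w \<inter> sg_cell q v \<Longrightarrow> y \<in> sg_cell q w \<inter> sg_cell q v \<Longrightarrow> x = y"
proof (induction n arbitrary: w v x y)
  case (Suc n)
  obtain i w' j v' where w: "w = i # w'" "i < 3" "w' \<in> sg_words n"
    and v: "v = j # v'" "j < 3" "v' \<in> sg_words n"
    using Suc.prems(1,2) by (auto elim!: sg_words_SucE)
  obtain x1 x2 y1 y2 where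
    x: "x = sgF q i x1" "x = sgF q j x2" "x1 \<in> sg_cell q w'" "x2 \<in> sg_cell q v'" and
    y: "y = sgF q i y1" "y = sgF q j y2" "y1 \<in> sg_cell q w'" "y2 \<in> sg_cell q v'"
    using Suc.prems(4,5) unfolding w(1) v(1) sg_cell_Cons by blast
  show ?case
  proof (cases "i = j")
    case True
    then have "x1 = x2" "y1 = y2" using x y by (auto dest: sgF_inj)
    then have "x1 = y1" using Suc.IH[OF w(3) v(3)] x y Suc.prems(3) True w v by auto
    then show ?thesis by (simp add: x y)
  next
    case False
    have "x1 = q j" "y1 = q j"
      using first_level_cells_meet_in_junction[OF assms w(2) v(2) False]
        x y sg_cell_subset_SG[OF w(3)] sg_cell_subset_SG[OF v(3)] by blast+
    then show ?thesis by (simp add: x y)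
  qed
qed (simp add: sg_words_0)

lemma corner_in_sgV: "j < 3 \<Longrightarrow> q j \<in> sgV q n"
proof (induction n)
  case 0
  then have "j = 0 \<or> j = 1 \<or> j = 2" by linarith
  then show ?case by auto
next
  case (Suc n)
  have "sgF q j (q j) \<in> sgV q (Suc n)"
    unfolding sgV.simps using Suc by (intro UN_I[of j] imageI) auto
  then show ?case by (simp only: sgF_fixed)
qed

lemma sgFw_corner_in_sgV: "w \<in> sg_words n \<Longrightarrow> j < 3 \<Longrightarrow> sgFw q w (q j) \<in> sgV q n"
proof (induction n arbitrary: w)
  case 0
  then show ?case using corner_in_sgV[of j q 0] by (simp add: sg_words_0)
next
  case (Suc n)
  then obtain i v where "w = i # v" "i < 3" "v \<in> sg_words n" by (auto elim: sg_words_SucE)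
  then show ?case using Suc by auto
qed

lemma sgV_subset_SG: "sgV q n \<subseteq> SG q"
proof (induction n)
  case 0
  then show ?case using corner_in_SG[of 0 q] corner_in_SG[of 1 q] corner_in_SG[of 2 q] by simp
next
  case (Suc n)
  then show ?case using SG_invariant[of q] unfolding sgV.simps by blast
qed

text \<open>Two descriptions of a vertex have to be compared, its address in \<open>sgV\<close> and the cell that
contains it. If they begin with different letters, the vertex is a junction point of
the first level and so the image of a corner, which lies in every \<open>sgV q n\<close>.\<close>

lemma sgV_Int_cell:
  assumes eq: "equilateral q"
  shows "w \<in> sg_words n \<Longrightarrow> sgV q n \<inter> sg_cell q w = (\<lambda>j. sgFw q w (q j)) ` {..<3}"
proof (intro equalityI subsetI)
  fix x assume "w \<in> sg_words n" "x \<in> (\<lambda>j. sgFw q w (q j)) ` {..<3}"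
  then show "x \<in> sgV q n \<inter> sg_cell q w"
    by (auto simp: sgFw_corner_in_sgV sg_cell_def corner_in_SG)
next
  fix x
  show "w \<in> sg_words n \<Longrightarrow> x \<in> sgV q n \<inter> sg_cell q w \<Longrightarrow> x \<in> (\<lambda>j. sgFw q w (q j)) ` {..<3}"
  proof (induction n arbitrary: w x)
    case 0
    then have "x \<in> {q 0, q 1, q 2}" by (simp add: sg_words_0)
    then obtain j where "j < 3" "x = q j" by (auto intro: that[of 0] that[of 1] that[of 2])
    then show ?case using 0 by (simp add: sg_words_0)
  next
    case (Suc n)
    obtain i v where w: "w = i # v" "i < 3" "v \<in> sg_words n"
      using Suc.prems(1) by (auto elim: sg_words_SucE)
    obtain s where s: "x = sgF q i s" "s \<in> sg_cell q v"
      using Suc.prems(2) unfolding w(1) sg_cell_Cons by blast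
    obtain j t where t: "j < 3" "t \<in> sgV q n" "x = sgF q j t"
      using Suc.prems(2) by auto
    have "s \<in> sgV q n"
    proof (cases "i = j")
      case True
      then show ?thesis using s t sgF_inj by metis
    next
      case False
      have "t \<in> SG q" using t(2) sgV_subset_SG by blast
      then have "s = q j"
        using first_level_cells_meet_in_junction[OF eq w(2) t(1) False
            subsetD[OF sg_cell_subset_SG[OF w(3)] s(2)]] s(1) t(3) by simp
      then show ?thesis using corner_in_sgV t(1) by simp
    qed
    then show ?case using Suc.IH[OF w(3), of s] s w by auto
  qed
qed


lemma sg_cell_append_subset: "t \<in> sg_words k \<Longrightarrow> sg_cell q (v @ t) \<subseteq> sg_cell q v"
  by (auto simp: sg_cell_def sgFw_SG)

lemma sg_words_append: "v \<in> sg_words m \<Longrightarrow> t \<in> sg_words k \<Longrightarrow> v @ t \<in> sg_words (m + k)"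
  by (auto simp: sg_words_def)

text \<open>A cell of the finer level lies in exactly one cell of the coarser level, as it has at least two
points and different cells of one level share at most one.\<close>

lemma sg_cell_subset_cell_iff:
  assumes eq: "equilateral q" and v: "v \<in> sg_words m" and w: "w \<in> sg_words (m + k)"
  shows "sg_cell q w \<subseteq> sg_cell q v \<longleftrightarrow> (\<exists>t\<in>sg_words k. w = v @ t)"
proof
  assume sub: "sg_cell q w \<subseteq> sg_cell q v"
  have split: "take m w \<in> sg_words m" "drop m w \<in> sg_words k"
    using w set_take_subset[of m w] set_drop_subset[of m w] by (auto simp: sg_words_def)
  have sub': "sg_cell q w \<subseteq> sg_cell q (take m w)"
    using sg_cell_append_subset[OF split(2), of q "take m w"] by simp
  have "sgFw q w (q 0) \<noteq> sgFw q w (q 1)"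
    using distinct_corners[OF eq, of 0 1] by (simp add: sgFw_eq_iff)
  moreover have "sgFw q w (q 0) \<in> sg_cell q w" "sgFw q w (q 1) \<in> sg_cell q w"
    by (simp_all add: sg_cell_def corner_in_SG)
  ultimately have "take m w = v"
    using distinct_cells_meet_in_at_most_one_point[OF eq split(1) v,
        of "sgFw q w (q 0)" "sgFw q w (q 1)"] sub sub' by blast
  then show "\<exists>t\<in>sg_words k. w = v @ t" using split(2) by (metis append_take_drop_id)
qed (use sg_cell_append_subset in blast)

section \<open>Energy of a harmonic function on a cell\<close>

abbreviation corner_pairs :: "(nat \<times> nat) set" where
  "corner_pairs \<equiv> {(0, 1), (1, 0), (0, 2), (2, 0), (1, 2), (2, 1)}"

lemma corner_pairs_iff: "(i, j) \<in> corner_pairs \<longleftrightarrow> i < 3 \<and> j < 3 \<and> i \<noteq> j"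
  by auto

definition word_edge :: "(nat \<Rightarrow> complex) \<Rightarrow> nat list \<times> nat \<times> nat \<Rightarrow> complex \<times> complex" where
  "word_edge q = (\<lambda>(w, i, j). (sgFw q w (q i), sgFw q w (q j)))"

text \<open>A vertex of level \<open>m + k\<close> in a cell of that level is one of its three corners, and
the cells of that level inside the cell of \<open>v\<close> are those whose words extend \<open>v\<close>.\<close>

lemma sg_edges_eq_image:
  assumes eq: "equilateral q" and v: "v \<in> sg_words m"
  shows "sg_edges q (m + k) (sg_cell q v) = word_edge q ` (((@) v ` sg_words k) \<times> corner_pairs)"
proof (intro equalityI subrelI)
  fix x y assume "(x, y) \<in> sg_edges q (m + k) (sg_cell q v)"
  then obtain w where xy: "x \<in> sgV q (m + k)" "y \<in> sgV q (m + k)" "x \<noteq> y"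
      "x \<in> sg_cell q w" "y \<in> sg_cell q w"
    and w: "w \<in> sg_words (m + k)" "sg_cell q w \<subseteq> sg_cell q v"
    unfolding sg_edges_def by blast
  have "x \<in> (\<lambda>j. sgFw q w (q j)) ` {..<3}" "y \<in> (\<lambda>j. sgFw q w (q j)) ` {..<3}"
    unfolding sgV_Int_cell[OF eq w(1), symmetric] using xy by blast+
  then obtain i j where "i < 3" "j < 3" "x = sgFw q w (q i)" "y = sgFw q w (q j)" by blast
  then have "(i, j) \<in> corner_pairs" "(x, y) = word_edge q (w, i, j)"
    using xy(3) unfolding corner_pairs_iff by (auto simp: word_edge_def)
  moreover have "w \<in> (@) v ` sg_words k"
    using w(2) unfolding sg_cell_subset_cell_iff[OF eq v w(1)] by blast
  ultimately show "(x, y) \<in> word_edge q ` (((@) v ` sg_words k) \<times> corner_pairs)" by blast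
next
  fix x y assume "(x, y) \<in> word_edge q ` (((@) v ` sg_words k) \<times> corner_pairs)"
  then obtain t i j where t: "t \<in> sg_words k" and ij: "(i, j) \<in> corner_pairs"
    and "(x, y) = word_edge q (v @ t, i, j)"
    by blast
  then have xy: "x = sgFw q (v @ t) (q i)" "y = sgFw q (v @ t) (q j)"
    by (simp_all only: word_edge_def prod.case prod.inject)
  have ij: "i < 3" "j < 3" "i \<noteq> j" using ij unfolding corner_pairs_iff by blast+
  have w: "v @ t \<in> sg_words (m + k)" by (rule sg_words_append[OF v t])
  have "x \<noteq> y" unfolding xy sgFw_eq_iff using ij distinct_corners[OF eq] by blast
  moreover have "x \<in> sgV q (m + k) \<inter> sg_cell q (v @ t)" "y \<in> sgV q (m + k) \<inter> sg_cell q (v @ t)"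
    unfolding sgV_Int_cell[OF eq w] xy using ij by blast+
  ultimately show "(x, y) \<in> sg_edges q (m + k) (sg_cell q v)"
    using w sg_cell_append_subset[OF t, of q v] unfolding sg_edges_def by blast
qed

text \<open>The two endpoints of an edge determine its cell, because two different cells of one level cannot
share two points.\<close>

lemma inj_on_word_edge:
  assumes eq: "equilateral q" and W: "W \<subseteq> sg_words n"
  shows "inj_on (word_edge q) (W \<times> corner_pairs)"
proof (rule inj_onI)
  fix p p' assume p: "p \<in> W \<times> corner_pairs" "p' \<in> W \<times> corner_pairs"
    and e: "word_edge q p = word_edge q p'"
  obtain w i j where p1: "p = (w, i, j)" by (metis prod_cases3)
  obtain w' i' j' where p2: "p' = (w', i', j')" by (metis prod_cases3)
  have w: "w \<in> sg_words n" "w' \<in> sg_words n"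
    and ij: "(i, j) \<in> corner_pairs" "(i', j') \<in> corner_pairs"
    using p W unfolding p1 p2 by blast+
  have ij: "i < 3" "j < 3" "i \<noteq> j" "i' < 3" "j' < 3" "i' \<noteq> j'"
    using ij unfolding corner_pairs_iff by blast+
  have e1: "sgFw q w (q i) = sgFw q w' (q i')" and e2: "sgFw q w (q j) = sgFw q w' (q j')"
    using e unfolding p1 p2 word_edge_def by simp_all
  have ne: "sgFw q w (q i) \<noteq> sgFw q w (q j)"
    unfolding sgFw_eq_iff using ij distinct_corners[OF eq] by blast
  have mem: "sgFw q u (q l) \<in> sg_cell q u" if "l < 3" for u l
    using that by (simp add: sg_cell_def corner_in_SG)
  have "w = w'"
  proof (rule ccontr)
    assume "w \<noteq> w'"
    then have "sgFw q w (q i) = sgFw q w (q j)"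
      using distinct_cells_meet_in_at_most_one_point[OF eq w] mem[of i w] mem[of j w]
        mem[of i' w'] mem[of j' w'] ij e1 e2 by auto
    with ne show False by blast
  qed
  then have "q i = q i'" "q j = q j'" using e1 e2 by (simp_all add: sgFw_eq_iff)
  then show "p = p'" using distinct_corners[OF eq] ij \<open>w = w'\<close> by (simp add: p1 p2)
qed

definition corner_energy :: "(nat \<Rightarrow> complex) \<Rightarrow> (complex \<Rightarrow> real) \<Rightarrow> nat list \<Rightarrow> real" where
  "corner_energy q u w =
     (u (sgFw q w (q 0)) - u (sgFw q w (q 1)))\<^sup>2 +
     (u (sgFw q w (q 0)) - u (sgFw q w (q 2)))\<^sup>2 +
     (u (sgFw q w (q 1)) - u (sgFw q w (q 2)))\<^sup>2"

lemma sg_level_energy_eq_sum: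
  assumes eq: "equilateral q" and v: "v \<in> sg_words m"
  shows "sg_level_energy q (m + k) (sg_cell q v) u =
    (5/3)^(m + k) * (\<Sum>t\<in>sg_words k. corner_energy q u (v @ t))"
proof -
  have W: "(@) v ` sg_words k \<subseteq> sg_words (m + k)" using sg_words_append[OF v] by blast
  define g where "g = (\<lambda>(x, y). (5/3)^(m + k) * (u x - u y)\<^sup>2)"
  have "(\<Sum>e\<in>sg_edges q (m + k) (sg_cell q v). g e) =
      (\<Sum>p\<in>((@) v ` sg_words k) \<times> corner_pairs. g (word_edge q p))"
    unfolding sg_edges_eq_image[OF eq v] by (subst sum.reindex[OF inj_on_word_edge[OF eq W]]) simp
  also have "\<dots> = (\<Sum>w\<in>(@) v ` sg_words k. \<Sum>p\<in>corner_pairs. g (word_edge q (w, p)))"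
    unfolding sum.cartesian_product by (simp only: case_prod_unfold prod.collapse)
  also have "\<dots> = (\<Sum>w\<in>(@) v ` sg_words k. 2 * ((5/3)^(m + k) * corner_energy q u w))"
    by (intro sum.cong refl)
      (simp add: g_def word_edge_def corner_energy_def power2_eq_square algebra_simps)
  also have "\<dots> = (\<Sum>t\<in>sg_words k. 2 * ((5/3)^(m + k) * corner_energy q u (v @ t)))"
    by (subst sum.reindex) (auto simp: inj_on_def)
  finally show ?thesis
    by (simp add: sg_level_energy_def g_def sum_distrib_left[symmetric])
qed

lemma sum_sg_words_Suc:
  "(\<Sum>t\<in>sg_words (Suc k). g t) = (\<Sum>t\<in>sg_words k. \<Sum>i<3. g (t @ [i]))"
proof -
  have inj: "inj_on (\<lambda>(t, i). t @ [i]) (sg_words k \<times> {..<3::nat})" by (auto simp: inj_on_def)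
  have img: "sg_words (Suc k) = (\<lambda>(t, i). t @ [i]) ` (sg_words k \<times> {..<3})"
  proof (intro equalityI subsetI)
    fix w assume w: "w \<in> sg_words (Suc k)"
    then have "w \<noteq> []" by (auto simp: sg_words_def)
    then obtain t i where "w = t @ [i]" by (metis rev_exhaust)
    with w show "w \<in> (\<lambda>(t, i). t @ [i]) ` (sg_words k \<times> {..<3})"
      by (auto simp: sg_words_def image_iff)
  qed (auto simp: sg_words_def)
  show ?thesis
    unfolding img by (subst sum.reindex[OF inj]) (simp add: sum.cartesian_product case_prod_unfold)
qed

text \<open>The renormalization identity. The junction values are
\<open>(2 A + 2 B + C) / 5\<close> and its permutations, and the claim is a polynomial identity in the
corner values \<open>A\<close>, \<open>B\<close>, \<open>C\<close>.\<close>

lemma harmonic_extension_corner_energy: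
  assumes harm: "sg_harmonic_on q K u" and w: "w \<in> sg_words n" and sub: "sg_cell q w \<subseteq> K"
  shows "(\<Sum>i<3. corner_energy q u (w @ [i])) = 3/5 * corner_energy q u w"
proof -
  let ?c = "\<lambda>i. u (sgFw q w (q i))"
  have junction: "u (sgFw q w (sgF q i (q j))) = (2 * ?c i + 2 * ?c j + ?c k) / 5"
    if "{i, j, k} = {0, 1, 2}" for i j k
    using harm w sub that unfolding sg_harmonic_on_def by blast
  have "u (sgFw q w (sgF q 0 (q 1))) = (2 * ?c 0 + 2 * ?c 1 + ?c 2) / 5"
    "u (sgFw q w (sgF q 1 (q 0))) = (2 * ?c 1 + 2 * ?c 0 + ?c 2) / 5"
    "u (sgFw q w (sgF q 0 (q 2))) = (2 * ?c 0 + 2 * ?c 2 + ?c 1) / 5"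
    "u (sgFw q w (sgF q 2 (q 0))) = (2 * ?c 2 + 2 * ?c 0 + ?c 1) / 5"
    "u (sgFw q w (sgF q 1 (q 2))) = (2 * ?c 1 + 2 * ?c 2 + ?c 0) / 5"
    "u (sgFw q w (sgF q 2 (q 1))) = (2 * ?c 2 + 2 * ?c 1 + ?c 0) / 5"
    by (intro junction; blast)+
  note junctions = this
  define A B C where "A = ?c 0" and "B = ?c 1" and "C = ?c 2"
  have "{..<3::nat} = {0, 1, 2}" by auto
  then have "(\<Sum>i<3. corner_energy q u (w @ [i])) = corner_energy q u (w @ [0]) +
      corner_energy q u (w @ [1]) + corner_energy q u (w @ [2])" by simp
  also have "\<dots> = 3/5 * ((A - B)\<^sup>2 + (A - C)\<^sup>2 + (B - C)\<^sup>2)"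
    unfolding corner_energy_def sgFw_simps sgF_fixed junctions A_def[symmetric] B_def[symmetric]
      C_def[symmetric]
    by (simp add: power2_eq_square field_simps)
  finally show ?thesis by (simp add: corner_energy_def A_def B_def C_def)
qed

lemma harmonic_sum_corner_energy:
  assumes v: "v \<in> sg_words m" and harm: "sg_harmonic_on q (sg_cell q v) u"
  shows "(\<Sum>t\<in>sg_words k. corner_energy q u (v @ t)) = (3/5)^k * corner_energy q u v"
proof (induction k)
  case 0
  then show ?case by (simp add: sg_words_0)
next
  case (Suc k)
  have "(\<Sum>i<3. corner_energy q u (v @ t @ [i])) = 3/5 * corner_energy q u (v @ t)"
    if "t \<in> sg_words k" for t
    using harmonic_extension_corner_energy[OF harm sg_words_append[OF v that]
        sg_cell_append_subset[OF that]] by simp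
  then have "(\<Sum>t\<in>sg_words (Suc k). corner_energy q u (v @ t)) =
      (\<Sum>t\<in>sg_words k. 3/5 * corner_energy q u (v @ t))"
    unfolding sum_sg_words_Suc by (intro sum.cong refl)
  then show ?case by (simp only: sum_distrib_left[symmetric] Suc.IH power_Suc mult.assoc)
qed

text \<open>The energies of all levels from \<open>m\<close> on are equal, so the limit that defines the energy is
that of an eventually constant sequence.\<close>

lemma harmonic_cell_energy:
  assumes eq: "equilateral q" and v: "v \<in> sg_words m"
    and harm: "sg_harmonic_on q (sg_cell q v) u"
  shows "sg_cell_energy q (sg_cell q v) u = ennreal ((5/3)^m * corner_energy q u v)"
proof -
  have "sg_level_energy q n (sg_cell q v) u = (5/3)^m * corner_energy q u v" if le: "m \<le> n" for n
  proof -
    obtain k where n: "n = m + k" using le_Suc_ex[OF le] by blast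
    have "(5/3::real)^k * (3/5)^k = 1" by (simp flip: power_mult_distrib)
    then show ?thesis
      unfolding n sg_level_energy_eq_sum[OF eq v] harmonic_sum_corner_energy[OF v harm]
      by (simp add: power_add)
  qed
  then have "(\<lambda>n. ennreal (sg_level_energy q n (sg_cell q v) u))
      \<longlonglongrightarrow> ennreal ((5/3)^m * corner_energy q u v)"
    by (intro tendsto_eventually eventually_sequentiallyI[of m]) simp
  then show ?thesis unfolding sg_cell_energy_def by (rule limI)
qed

section \<open>The half gasket as a ladder of cells\<close>

lemma funpow_sgF: "(sgF q j ^^ m) x = sgFw q (replicate m j) x"
  by (simp add: sgFw_def)

text \<open>The cell with this word is \<open>half_Y q (Suc m)\<close>; the index is shifted so that it runs over all
natural numbers.\<close>

definition rung :: "nat \<Rightarrow> nat list" where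
  "rung m = replicate m 0 @ [1]"

lemma rung_in_sg_words: "rung m \<in> sg_words (Suc m)"
  by (auto simp: rung_def sg_words_def)

lemma half_Y_Suc: "half_Y q (Suc m) = sg_cell q (rung m)"
  by (simp add: half_Y_def sg_cell_def rung_def image_image funpow_sgF)

lemma rung_corners:
  "sgFw q (rung m) (q 0) = half_y q (Suc m)"
  "sgFw q (rung m) (q 1) = half_y q m"
  "sgFw q (rung m) (q 2) = half_x q (Suc m)"
proof -
  have junction: "sgF q 1 (q 0) = sgF q 0 (q 1)" "sgF q 1 (q 2) = sgF q 2 (q 1)"
    by (simp_all only: sgF_def add.commute)
  show "sgFw q (rung m) (q 0) = half_y q (Suc m)"
    unfolding half_y_def funpow_Suc_right comp_def funpow_sgF by (simp only: rung_def sgFw_simps junction)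
  show "sgFw q (rung m) (q 1) = half_y q m"
    unfolding half_y_def funpow_sgF by (simp only: rung_def sgFw_simps sgF_fixed)
  show "sgFw q (rung m) (q 2) = half_x q (Suc m)"
    unfolding half_x_def diff_Suc_1 funpow_sgF by (simp only: rung_def sgFw_simps junction)
qed

lemma half_energy_eq_ladder_energy:
  assumes eq: "equilateral q" and sol: "half_bvp_solution q a u"
  shows "half_energy q u =
    (\<Sum>m. ennreal (ladder_energy (\<lambda>m. u (half_y q m) - A) (\<lambda>m. a m - A) m))"
proof -
  have "sg_cell_energy q (half_Y q (Suc m)) u =
      ennreal (ladder_energy (\<lambda>m. u (half_y q m) - A) (\<lambda>m. a m - A) m)" for m
  proof -
    have "sg_harmonic_on q (half_Y q (Suc m)) u" and x: "u (half_x q (Suc m)) = a (Suc m)"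
      using sol by (simp_all add: half_bvp_solution_def half_Laplace_zero_def)
    then show ?thesis
      using harmonic_cell_energy[OF eq rung_in_sg_words, of m u]
      by (simp add: half_Y_Suc corner_energy_def rung_corners ladder_energy_def x
          del: One_nat_def)
  qed
  then show ?thesis by (simp add: half_energy_def)
qed

lemma dist_funpow_sgF: "dist ((sgF q j ^^ m) x) (q j) = dist x (q j) / 2 ^ m"
proof (induction m)
  case (Suc m)
  then show ?case using sgF_dist[of q j "(sgF q j ^^ m) x" "q j"] by (simp add: sgF_fixed)
qed simp

lemma funpow_sgF_tendsto: "(\<lambda>m. (sgF q j ^^ m) x) \<longlonglongrightarrow> q j"
proof -
  have "(\<lambda>m. dist x (q j) * (1/2) ^ m) \<longlonglongrightarrow> dist x (q j) * 0"
    by (intro tendsto_mult tendsto_const LIMSEQ_power_zero) simp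
  then show ?thesis
    by (subst tendsto_dist_iff) (simp add: dist_funpow_sgF power_divide)
qed

lemma rung_corner_in_half_Omega_bar:
  assumes "j < 3"
  shows "sgFw q (rung m) (q j) \<in> half_Omega_bar q"
proof -
  have "sgFw q (rung m) (q j) \<in> half_Y q (Suc m)"
    using assms by (simp add: half_Y_Suc sg_cell_def corner_in_SG)
  then show ?thesis unfolding half_Omega_bar_def by fastforce
qed

lemma half_bvp_solution_tendsto:
  assumes lim: "a \<longlonglongrightarrow> A" and sol: "half_bvp_solution q a u"
  shows "(\<lambda>m. u (half_y q m)) \<longlonglongrightarrow> A"
proof -
  have cont: "continuous_on (half_Omega_bar q) u" and x: "\<And>m. u (half_x q (Suc m)) = a (Suc m)"
    using sol by (simp_all add: half_bvp_solution_def)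
  have q0: "q 0 \<in> half_Omega_bar q" by (simp add: half_Omega_bar_def)
  have mem: "half_x q (Suc m) \<in> half_Omega_bar q" "half_y q m \<in> half_Omega_bar q" for m
    using rung_corner_in_half_Omega_bar[of 2 q m] rung_corner_in_half_Omega_bar[of 1 q m]
    unfolding rung_corners by simp_all
  have "(\<lambda>m. half_x q (Suc m)) \<longlonglongrightarrow> q 0" "half_y q \<longlonglongrightarrow> q 0"
    unfolding half_x_def half_y_def[abs_def] diff_Suc_1 by (rule funpow_sgF_tendsto)+
  then have "(\<lambda>m. u (half_x q (Suc m))) \<longlonglongrightarrow> u (q 0)"
    and y: "(\<lambda>m. u (half_y q m)) \<longlonglongrightarrow> u (q 0)"
    using mem q0 by (auto intro!: continuous_on_tendsto_compose[OF cont])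
  moreover have "(\<lambda>m. u (half_x q (Suc m))) \<longlonglongrightarrow> A"
    unfolding x using lim by (rule LIMSEQ_Suc)
  ultimately have "u (q 0) = A" using LIMSEQ_unique by blast
  then show ?thesis using y by simp
qed

lemma half_bvp_solution_recursion:
  fixes A :: real
  assumes sol: "half_bvp_solution q a u"
  defines "b \<equiv> \<lambda>m. u (half_y q m) - A" and "c \<equiv> \<lambda>m. a m - A"
  shows "b 0 = c 0"
    and "16 * b (Suc m) - 3 * b m - 5 * b (Suc (Suc m)) = 3 * c (Suc m) + 5 * c (Suc (Suc m))"
proof -
  show "b 0 = c 0" using sol by (simp add: b_def c_def half_bvp_solution_def half_y_def)
  let ?y = "\<lambda>m. u (half_y q m)"
  have "(5/3)^Suc m * (2 * ?y (Suc m) - ?y m - a (Suc m)) +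
      (5/3)^(Suc m + 1) * (2 * ?y (Suc m) - ?y (Suc (Suc m)) - a (Suc (Suc m))) = 0"
    using sol unfolding half_bvp_solution_def half_Laplace_zero_def
    by (metis One_nat_def Suc_le_mono Suc_eq_plus1 diff_Suc_1 le0)
  then have "(5/3)^Suc m * ((2 * ?y (Suc m) - ?y m - a (Suc m)) +
      5/3 * (2 * ?y (Suc m) - ?y (Suc (Suc m)) - a (Suc (Suc m)))) = 0"
    by (simp only: power_add power_one_right distrib_left mult.assoc)
  then have "(2 * ?y (Suc m) - ?y m - a (Suc m)) +
      5/3 * (2 * ?y (Suc m) - ?y (Suc (Suc m)) - a (Suc (Suc m))) = 0"
    by simp
  then show "16 * b (Suc m) - 3 * b m - 5 * b (Suc (Suc m)) = 3 * c (Suc m) + 5 * c (Suc (Suc m))"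
    by (simp add: b_def c_def field_simps)
qed

lemma weighted_abs_power2: "\<bar>(5/3) powr (real m / 2) * x\<bar>\<^sup>2 = (5/3)^m * x\<^sup>2"
proof -
  have "((5/3) powr (real m / 2))\<^sup>2 = (5/3::real) ^ m"
    by (simp add: power2_eq_square powr_add[symmetric] powr_realpow)
  then show ?thesis by (simp add: power_mult_distrib)
qed

lemma ell2_norm_weighted:
  "ell2_norm (\<lambda>m. (5/3) powr (real m / 2) * c m) =
    (if summable (\<lambda>m. (5/3)^m * (c m)\<^sup>2) then ennreal (sqrt (\<Sum>m. (5/3)^m * (c m)\<^sup>2)) else \<infinity>)"
  unfolding ell2_norm_def weighted_abs_power2 ..

theorem theorem3p2:
  fixes q :: "nat \<Rightarrow> complex"
  assumes "equilateral q"
  shows "(\<forall>a A u. a \<longlonglongrightarrow> A \<longrightarrow> half_bvp_solution q a u \<longrightarrow>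
            (half_energy q u < \<infinity> \<longleftrightarrow>
             ell2_norm (\<lambda>m. (5/3) powr (real m / 2) * (a m - A)) < \<infinity>)) \<and>
         (\<exists>C>0. \<forall>a A u. a \<longlonglongrightarrow> A \<longrightarrow> half_bvp_solution q a u \<longrightarrow>
            half_energy q u \<le>
              ennreal C * (ell2_norm (\<lambda>m. (5/3) powr (real m / 2) * (a m - A)))\<^sup>2)"
proof -
  have *: "(half_energy q u < \<infinity> \<longleftrightarrow>
             ell2_norm (\<lambda>m. (5/3) powr (real m / 2) * (a m - A)) < \<infinity>) \<and>
           half_energy q u \<le>
             ennreal 700 * (ell2_norm (\<lambda>m. (5/3) powr (real m / 2) * (a m - A)))\<^sup>2"
    if lim: "a \<longlonglongrightarrow> A" and sol: "half_bvp_solution q a u" for a A u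
  proof -
    define b where "b m = u (half_y q m) - A" for m
    define c where "c m = a m - A" for m
    let ?S = "\<Sum>m. (5/3)^m * (c m)\<^sup>2"
    have energy: "half_energy q u = (\<Sum>m. ennreal (ladder_energy b c m))"
      using half_energy_eq_ladder_energy[OF assms sol, of A] by (simp add: b_def[abs_def] c_def[abs_def])
    have norm: "ell2_norm (\<lambda>m. (5/3) powr (real m / 2) * (a m - A)) =
        (if summable (\<lambda>m. (5/3)^m * (c m)\<^sup>2) then ennreal (sqrt ?S) else \<infinity>)"
      unfolding c_def by (rule ell2_norm_weighted)
    have b0: "b \<longlonglongrightarrow> 0"
      using tendsto_diff[OF half_bvp_solution_tendsto[OF lim sol] tendsto_const[of A]]
      by (simp add: b_def[abs_def])
    have rec: "b 0 = c 0"
        "\<And>m. 16 * b (Suc m) - 3 * b m - 5 * b (Suc (Suc m)) = 3 * c (Suc m) + 5 * c (Suc (Suc m))"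
      unfolding b_def c_def by (rule half_bvp_solution_recursion[OF sol])+
    show ?thesis
    proof (cases "summable (\<lambda>m. (5/3)^m * (c m)\<^sup>2)")
      case True
      note bound = ladder_energy_bound[OF b0 rec True]
      have S: "0 \<le> ?S" by (intro suminf_nonneg True) simp
      have "half_energy q u = ennreal (\<Sum>m. ladder_energy b c m)"
        unfolding energy by (intro suminf_ennreal2 ladder_energy_nonneg bound)
      moreover have "ennreal 700 * (ennreal (sqrt ?S))\<^sup>2 = ennreal (700 * ?S)"
        using S by (simp add: ennreal_power ennreal_mult')
      ultimately show ?thesis
        using bound(2) True by (simp add: norm ennreal_leI)
    next
      case False
      have "half_energy q u = \<infinity>"
      proof (rule ccontr)
        assume "half_energy q u \<noteq> \<infinity>"
        then have "summable (ladder_energy b c)"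
          unfolding energy by (intro summable_suminf_not_top ladder_energy_nonneg) auto
        then show False using ladder_energy_coercive[OF b0] False by blast
      qed
      then show ?thesis using False by (simp add: norm ennreal_mult_top)
    qed
  qed
  show ?thesis
    by (intro conjI exI[of _ 700]) (use * in auto)
qed

end
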